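(* Let $1\le m<d$, $\sigma>0$, $\mu_1,\dots,\mu_m\in\mathbb{R}$, and let $\epsilon,\epsilon_1,\dots,\epsilon_d$ be independent Gaussian random variables with mean $0$ and standard deviation $\sigma$. Let $X=(\mu_1+\epsilon_1+\epsilon,\dots,\mu_m+\epsilon_m+\epsilon,\epsilon_{m+1},\dots,\epsilon_d)\in\mathbb{R}^d/\mathbb{R}{\bf 1}$, and let $X'\in\mathbb{R}^d/\mathbb{R}{\bf 1}$ be the projected point of $X$ onto the $(m-1)$-dimensional Stiefel tropical linear space $L(A_{m-1})$ of the $m\times d$ matrix $A_{m-1}$ whose $(i,j)$ entry is $\mu_i$ if $j=i$, $-\infty$ if $j\le m$ and $j\ne i$, and $0$ if $j>m$: $$A_{m-1}=\begin{pmatrix}\mu_1&-\infty&\cdots&-\infty&0&\cdots&0\\-\infty&\mu_2&\cdots&-\infty&0&\cdots&0\\\vdots&\vdots&\ddots&\vdots&\vdots&&\vdots\\-\infty&-\infty&\cdots&\mu_m&0&\cdots&0\end{pmatrix}.$$ Then $\lim_{\sigma\to 0}\mathbb{E}[d_{\rm tr}(X,X')]=0$.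
   Context: ${\bf 1}=(1,\dots,1)$, $[d]=\{1,\dots,d\}$. Tropical distance: $d_{\rm tr}(v,w)=\max_i(v_i-w_i)-\min_i(v_i-w_i)$. The tropical determinant of a $q\times q$ matrix $B$ over $\mathbb{R}\cup\{-\infty\}$ is $\mathrm{tdet}(B)=\max_{\sigma\in S_q}\sum_{i}B_{i,\sigma(i)}$. For an $m\times d$ matrix $A$ with $m<d$, $p_A(\omega)=\mathrm{tdet}(A_\omega)$ for $m$-subsets $\omega\subseteq[d]$, where $A_\omega$ consists of the columns of $A$ indexed by $\omega$; these are the tropical Plücker coordinates. The Stiefel tropical linear space $L(A)$ is the set of $x\in(\mathbb{R}\cup\{-\infty\})^d/\mathbb{R}{\bf 1}$ such that for every $(m+1)$-subset $\tau\subseteq[d]$ the maximum of $p_A(\tau\setminus\{t\})+x_t$ over $t\in\tau$ is attained at least twice. The projected point of $u\in\mathbb{R}^d/\mathbb{R}{\bf 1}$ onto $L(A)$ is the point $w$ given by the Blue Rule: $w_i=\max_{\tau}\min_{j\notin\tau}\{u_j+p_A(\tau\cup\{i\})-p_A(\tau\cup\{j\})\}$, where $\tau$ runs over $(m-1)$-subsets of $[d]$ not containing $i$; it is a known fact that $w\in L(A)$ and $w$ minimizes $d_{\rm tr}(u,\cdot)$ over $L(A)$. *)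

theory Defs
  imports "HOL-Probability.Probability"
begin

text \<open>
  The coordinate set \<open>[d]\<close> is \<open>{1..d}\<close>; matrices and vectors are functions of which only the
  entries with indices in range matter. Entries in \<open>\<real> \<union> {-\<infinity>}\<close> are of type
  \<^typ>\<open>ereal\<close>. Points of the tropical torus \<open>\<real>\<^sup>d / \<real>1\<close> are given by representatives;
  \<open>trop_dist_shift\<close> and \<open>projected_point_shift\<close> below show that nothing depends on the choice.
\<close>

definition trop_dist :: "nat \<Rightarrow> (nat \<Rightarrow> ereal) \<Rightarrow> (nat \<Rightarrow> ereal) \<Rightarrow> ereal" where
  "trop_dist d v w = Max ((\<lambda>i. v i - w i) ` {1..d}) - Min ((\<lambda>i. v i - w i) ` {1..d})"

definition tdet :: "nat \<Rightarrow> (nat \<Rightarrow> nat \<Rightarrow> ereal) \<Rightarrow> ereal" where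
  "tdet q B = Max ((\<lambda>\<pi>. \<Sum>i = 1..q. B i (\<pi> i)) ` {\<pi>. \<pi> permutes {1..q}})"

definition column_submatrix :: "(nat \<Rightarrow> nat \<Rightarrow> ereal) \<Rightarrow> nat set \<Rightarrow> nat \<Rightarrow> nat \<Rightarrow> ereal" where
  "column_submatrix A \<omega> = (\<lambda>i k. A i (sorted_list_of_set \<omega> ! (k - 1)))"

definition plucker :: "nat \<Rightarrow> (nat \<Rightarrow> nat \<Rightarrow> ereal) \<Rightarrow> nat set \<Rightarrow> ereal" where
  "plucker m A \<omega> = tdet m (column_submatrix A \<omega>)"

text \<open>The Stiefel tropical linear space \<open>L(A)\<close>, as a set of representatives.\<close>

definition stiefel_space :: "nat \<Rightarrow> nat \<Rightarrow> (nat \<Rightarrow> nat \<Rightarrow> ereal) \<Rightarrow> (nat \<Rightarrow> ereal) set" where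
  "stiefel_space m d A = {x. (\<forall>i\<in>{1..d}. x i \<noteq> \<infinity>) \<and>
     (\<forall>\<tau>. \<tau> \<subseteq> {1..d} \<and> card \<tau> = m + 1 \<longrightarrow>
       (\<exists>s\<in>\<tau>. \<exists>t\<in>\<tau>. s \<noteq> t \<and>
         plucker m A (\<tau> - {s}) + x s = plucker m A (\<tau> - {t}) + x t \<and>
         (\<forall>r\<in>\<tau>. plucker m A (\<tau> - {r}) + x r \<le> plucker m A (\<tau> - {s}) + x s)))}"

text \<open>
  The projected point of \<open>u\<close> onto \<open>L(A)\<close> is defined by the Blue Rule, which refers to
  \<open>L(A)\<close> only through its Plucker coordinates. The rule is meant for matrices whose Plucker
  coordinates are all finite, as is the case for \<open>gauss_matrix\<close> below
  (on \<^typ>\<open>ereal\<close> the difference of two equal infinities is \<open>\<infinity>\<close>).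
\<close>

definition projected_point ::
    "nat \<Rightarrow> nat \<Rightarrow> (nat \<Rightarrow> nat \<Rightarrow> ereal) \<Rightarrow> (nat \<Rightarrow> real) \<Rightarrow> nat \<Rightarrow> ereal" where
  "projected_point m d A u i =
     Max ((\<lambda>\<tau>. Min ((\<lambda>j. ereal (u j) + plucker m A (insert i \<tau>) - plucker m A (insert j \<tau>))
                      ` ({1..d} - \<tau>)))
          ` {\<tau>. \<tau> \<subseteq> {1..d} \<and> card \<tau> = m - 1 \<and> i \<notin> \<tau>})"

definition gauss_matrix :: "nat \<Rightarrow> (nat \<Rightarrow> real) \<Rightarrow> nat \<Rightarrow> nat \<Rightarrow> ereal" where
  "gauss_matrix m \<mu> i j = (if j = i then ereal (\<mu> i) else if j \<le> m then -\<infinity> else 0)"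

text \<open>Here \<open>e\<close> is the value of the common noise \<open>\<epsilon>\<close> and \<open>es i\<close> that of \<open>\<epsilon>\<^sub>i\<close>.\<close>

definition sample_point :: "nat \<Rightarrow> (nat \<Rightarrow> real) \<Rightarrow> real \<Rightarrow> (nat \<Rightarrow> real) \<Rightarrow> nat \<Rightarrow> real" where
  "sample_point m \<mu> e es i = (if i \<le> m then \<mu> i + es i + e else es i)"

lemma Max_shift_ereal:
  fixes f :: "'b \<Rightarrow> ereal"
  assumes "finite S" "S \<noteq> {}"
  shows "Max ((\<lambda>i. f i + ereal c) ` S) = Max (f ` S) + ereal c"
  using mono_Max_commute[of "\<lambda>x. x + ereal c" "f ` S"] assms
  by (simp add: image_image mono_def add_right_mono)

lemma Min_shift_ereal:
  fixes f :: "'b \<Rightarrow> ereal"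
  assumes "finite S" "S \<noteq> {}"
  shows "Min ((\<lambda>i. f i + ereal c) ` S) = Min (f ` S) + ereal c"
  using mono_Min_commute[of "\<lambda>x. x + ereal c" "f ` S"] assms
  by (simp add: image_image mono_def add_right_mono)

lemma trop_dist_shift:
  assumes "d \<ge> 1"
  shows "trop_dist d (\<lambda>i. v i + ereal a) (\<lambda>i. w i + ereal b) = trop_dist d v w"
proof -
  have eq: "(v i + ereal a) - (w i + ereal b) = (v i - w i) + ereal (a - b)" for i
    by (cases "v i"; cases "w i") auto
  have canc: "(x + ereal c) - (y + ereal c) = x - y" for x y :: ereal and c
    by (cases x; cases y) auto
  show ?thesis
    using assms unfolding trop_dist_def eq
    by (subst Max_shift_ereal Min_shift_ereal; simp add: canc Min_shift_ereal)
qed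

lemma projected_point_shift:
  assumes "m \<le> d" "i \<in> {1..d}" "m \<ge> 1"
  shows "projected_point m d A (\<lambda>j. u j + c) i = projected_point m d A u i + ereal c"
proof -
  let ?T = "{\<tau>. \<tau> \<subseteq> {1..d} \<and> card \<tau> = m - 1 \<and> i \<notin> \<tau>}"
  let ?f = "\<lambda>\<tau> j. ereal (u j) + plucker m A (insert i \<tau>) - plucker m A (insert j \<tau>)"
  have "m - 1 \<le> card ({1..d} - {i})" using assms by simp
  then obtain \<tau>0 where "\<tau>0 \<subseteq> {1..d} - {i}" "card \<tau>0 = m - 1"
    by (meson obtain_subset_with_card_n)
  then have T: "finite ?T" "?T \<noteq> {}" by (auto intro: finite_subset[of _ "Pow {1..d}"])
  have f: "ereal (u j + c) + plucker m A (insert i \<tau>) - plucker m A (insert j \<tau>)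
           = ?f \<tau> j + ereal c" for \<tau> j
    by (cases "plucker m A (insert i \<tau>)"; cases "plucker m A (insert j \<tau>)") auto
  have "Min ((\<lambda>j. ?f \<tau> j + ereal c) ` ({1..d} - \<tau>)) = Min (?f \<tau> ` ({1..d} - \<tau>)) + ereal c"
    if "\<tau> \<in> ?T" for \<tau>
    using that assms by (intro Min_shift_ereal) auto
  then have "projected_point m d A (\<lambda>j. u j + c) i
      = Max ((\<lambda>\<tau>. Min (?f \<tau> ` ({1..d} - \<tau>)) + ereal c) ` ?T)"
    unfolding projected_point_def f by (intro arg_cong[where f = Max] image_cong refl) blast
  then show ?thesis
    unfolding projected_point_def using Max_shift_ereal[OF T] by simp
qed

end

theory Submission
  imports Defs
begin

text \<open>
  The tropical linear space is a translate of the one of a uniform matroid. Let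
  \<open>c = (\<mu>\<^sub>1, \<dots>, \<mu>\<^sub>m, 0, \<dots>, 0)\<close>. Every entry in column \<open>j\<close> of the matrix is \<open>c\<^sub>j\<close> or
  \<open>-\<infinity>\<close>, and the finite entries admit a perfect matching of the rows with any \<open>m\<close> columns:
  match row \<open>i\<close> with column \<open>i\<close> if that column is present, and the other rows arbitrarily with
  the columns beyond \<open>m\<close>. Hence the Plucker coordinate of \<open>\<omega>\<close> is the sum of \<open>c\<close> over \<open>\<omega>\<close>
  (\<open>plucker_gauss_matrix\<close>).

  In the Blue Rule these sums telescope to
  \<open>w\<^sub>i = c\<^sub>i + max\<^sub>\<tau> min\<^sub>j (u\<^sub>j - c\<^sub>j)\<close>. So if \<open>u\<close> is within \<open>N\<close> of \<open>c\<close> in every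
  coordinate, then so is \<open>w\<close>, and \<open>d\<^sub>t\<^sub>r(u, w) \<le> 4 N\<close> (\<open>trop_dist_projected_point_le\<close>).
  The sample point is \<open>c\<close> plus noise, and \<open>N = \<bar>\<epsilon>\<bar> + \<Sum>\<^sub>i \<bar>\<epsilon>\<^sub>i\<bar>\<close> bounds the noise. Its
  expectation is \<open>(d + 1) \<sigma> sqrt (2 / \<pi>)\<close>, a multiple of \<open>\<sigma>\<close>.
\<close>

definition centre :: "nat \<Rightarrow> (nat \<Rightarrow> real) \<Rightarrow> nat \<Rightarrow> real" where
  "centre m \<mu> j = (if j \<le> m then \<mu> j else 0)"

lemma gauss_matrix_eq:
  assumes "i \<le> m"
  shows "gauss_matrix m \<mu> i j = (if j = i \<or> m < j then ereal (centre m \<mu> j) else -\<infinity>)"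
  using assms by (auto simp: gauss_matrix_def centre_def zero_ereal_def)

text \<open>
  The perfect matching: \<open>{1..m} - \<omega>\<close> and \<open>\<omega> - {1..m}\<close> have the same size, so any bijection
  between them extends the identity on \<open>{1..m} \<inter> \<omega>\<close>.
\<close>

lemma obtain_matching_fixing_common:
  fixes m :: nat
  assumes "finite \<omega>" "card \<omega> = m"
  obtains f where "bij_betw f {1..m} \<omega>"
    and "\<And>i. i \<in> {1..m} \<Longrightarrow> f i = i \<or> f i \<notin> {1..m}"
proof -
  have "card ({1..m} - \<omega>) = card (\<omega> - {1..m})"
    using assms by (simp add: card_Diff_subset_Int Int_commute)
  then obtain g where g: "bij_betw g ({1..m} - \<omega>) (\<omega> - {1..m})"
    using assms by (metis finite_Diff finite_atLeastAtMost finite_same_card_bij)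
  let ?f = "\<lambda>i. if i \<in> {1..m} - \<omega> then g i else i"
  have 1: "bij_betw ?f ({1..m} - \<omega>) (\<omega> - {1..m})"
    using g by (rule bij_betw_cong[THEN iffD1, rotated]) auto
  have 2: "bij_betw ?f ({1..m} \<inter> \<omega>) ({1..m} \<inter> \<omega>)"
    using bij_betw_id[of "{1..m} \<inter> \<omega>"] by (rule bij_betw_cong[THEN iffD1, rotated]) auto
  have "bij_betw ?f (({1..m} - \<omega>) \<union> ({1..m} \<inter> \<omega>)) ((\<omega> - {1..m}) \<union> ({1..m} \<inter> \<omega>))"
    using bij_betw_combine[OF 1 2] by blast
  moreover have "({1..m} - \<omega>) \<union> ({1..m} \<inter> \<omega>) = {1..m}" "(\<omega> - {1..m}) \<union> ({1..m} \<inter> \<omega>) = \<omega>"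
    by auto
  ultimately have bij: "bij_betw ?f {1..m} \<omega>" by simp
  have "?f i = i \<or> ?f i \<notin> {1..m}" if "i \<in> {1..m}" for i
    using bij_betw_apply[OF g, of i] that by (cases "i \<in> \<omega>") auto
  with bij show thesis by (rule that)
qed

lemma bij_betw_sorted_list_of_set_nth:
  assumes "finite \<omega>" "card \<omega> = m"
  shows "bij_betw (\<lambda>k. sorted_list_of_set \<omega> ! (k - 1)) {1..m} \<omega>"
proof -
  have 1: "bij_betw (\<lambda>k. k - 1) {1..m} {..<m}"
    by (rule bij_betw_byWitness[where f' = Suc]) auto
  have "bij_betw ((!) (sorted_list_of_set \<omega>)) {..<m} \<omega>"
    using assms by (intro bij_betw_nth) auto
  from bij_betw_trans[OF 1 this] show ?thesis by (simp add: o_def)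
qed

text \<open>
  No permutation does better than the sum of the column values, because each column is used once;
  the matching above attains it.
\<close>

lemma plucker_gauss_matrix:
  assumes \<omega>: "finite \<omega>" "card \<omega> = m" "0 \<notin> \<omega>"
  shows "plucker m (gauss_matrix m \<mu>) \<omega> = ereal (sum (centre m \<mu>) \<omega>)"
proof -
  define col where "col k = sorted_list_of_set \<omega> ! (k - 1)" for k
  have col: "bij_betw col {1..m} \<omega>"
    unfolding col_def using bij_betw_sorted_list_of_set_nth[OF \<omega>(1,2)] .
  let ?t = "\<lambda>\<pi>. \<Sum>i = 1..m. gauss_matrix m \<mu> i (col (\<pi> i))"
  have total: "(\<Sum>i = 1..m. ereal (centre m \<mu> (f i))) = ereal (sum (centre m \<mu>) \<omega>)"
    if "bij_betw f {1..m} \<omega>" for f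
    using sum.reindex_bij_betw[OF that, of "centre m \<mu>"] by simp
  have upper: "?t \<pi> \<le> ereal (sum (centre m \<mu>) \<omega>)" if "\<pi> permutes {1..m}" for \<pi>
  proof -
    have "bij_betw (\<lambda>i. col (\<pi> i)) {1..m} \<omega>"
      using bij_betw_trans[OF permutes_imp_bij[OF that] col] by (simp add: o_def)
    from total[OF this] have "ereal (sum (centre m \<mu>) \<omega>) = (\<Sum>i = 1..m. ereal (centre m \<mu> (col (\<pi> i))))"
      by (rule sym)
    moreover have "?t \<pi> \<le> (\<Sum>i = 1..m. ereal (centre m \<mu> (col (\<pi> i))))"
      by (intro sum_mono) (simp add: gauss_matrix_eq)
    ultimately show ?thesis by simp
  qed
  obtain f where f: "bij_betw f {1..m} \<omega>"
    and fix_f: "\<And>i. i \<in> {1..m} \<Longrightarrow> f i = i \<or> f i \<notin> {1..m}"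
    using obtain_matching_fixing_common[OF \<omega>(1,2)] by blast
  \<comment> \<open>\<open>f\<close> sends rows to columns; \<open>tdet\<close> wants the positions of these columns within \<open>\<omega>\<close>.\<close>
  let ?\<pi> = "\<lambda>i. if i \<in> {1..m} then inv_into {1..m} col (f i) else i"
  have "bij_betw (inv_into {1..m} col \<circ> f) {1..m} {1..m}"
    using f bij_betw_inv_into[OF col] by (rule bij_betw_trans)
  then have "bij_betw ?\<pi> {1..m} {1..m}"
    by (rule bij_betw_cong[THEN iffD1, rotated]) auto
  then have \<pi>: "?\<pi> permutes {1..m}"
    by (rule bij_imp_permutes) auto
  have "gauss_matrix m \<mu> i (col (?\<pi> i)) = ereal (centre m \<mu> (f i))" if i: "i \<in> {1..m}" for i
  proof -
    have fi: "f i \<in> \<omega>" using bij_betw_apply[OF f i] .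
    then have "col (?\<pi> i) = f i"
      using i col by (simp add: bij_betw_inv_into_right)
    moreover have "f i = i \<or> m < f i"
      using fix_f[OF i] fi \<omega>(3) by (metis atLeastAtMost_iff less_one not_le)
    ultimately show ?thesis using i by (simp add: gauss_matrix_eq)
  qed
  then have "?t ?\<pi> = (\<Sum>i = 1..m. ereal (centre m \<mu> (f i)))"
    by (intro sum.cong) auto
  then have "?t ?\<pi> = ereal (sum (centre m \<mu>) \<omega>)"
    using total[OF f] by simp
  moreover have "finite {\<pi>. \<pi> permutes {1..m}}" by (simp add: finite_permutations)
  ultimately have "Max (?t ` {\<pi>. \<pi> permutes {1..m}}) = ereal (sum (centre m \<mu>) \<omega>)"
    using upper \<pi> by (intro Max_eqI) (auto intro!: image_eqI[of _ _ ?\<pi>])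
  then show ?thesis
    by (simp add: plucker_def tdet_def column_submatrix_def col_def)
qed

lemma Max_image_between:
  fixes f :: "'b \<Rightarrow> 'c::linorder"
  assumes "finite S" "S \<noteq> {}" "\<And>x. x \<in> S \<Longrightarrow> f x \<in> {a..b}"
  shows "Max (f ` S) \<in> {a..b}"
  using Max_in[of "f ` S"] assms by fastforce

lemma Min_image_between:
  fixes f :: "'b \<Rightarrow> 'c::linorder"
  assumes "finite S" "S \<noteq> {}" "\<And>x. x \<in> S \<Longrightarrow> f x \<in> {a..b}"
  shows "Min (f ` S) \<in> {a..b}"
  using Min_in[of "f ` S"] assms by fastforce

text \<open>
  The Plucker coordinates of \<open>\<tau> \<union> {i}\<close> and \<open>\<tau> \<union> {j}\<close> differ by \<open>c\<^sub>i - c\<^sub>j\<close>, so every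
  term of the Blue Rule is \<open>c\<^sub>i\<close> plus a deviation \<open>u\<^sub>j - c\<^sub>j\<close>.
\<close>

lemma projected_point_near_centre:
  assumes md: "1 \<le> m" "m < d" and i: "i \<in> {1..d}"
    and u: "\<And>j. j \<in> {1..d} \<Longrightarrow> \<bar>u j - centre m \<mu> j\<bar> \<le> N"
  shows "projected_point m d (gauss_matrix m \<mu>) u i
           \<in> {ereal (centre m \<mu> i - N)..ereal (centre m \<mu> i + N)}"
proof -
  let ?T = "{\<tau>. \<tau> \<subseteq> {1..d} \<and> card \<tau> = m - 1 \<and> i \<notin> \<tau>}"
  let ?p = "plucker m (gauss_matrix m \<mu>)"
  have "m - 1 \<le> card ({1..d} - {i})" using md i by simp
  then obtain \<tau>0 where "\<tau>0 \<subseteq> {1..d} - {i}" "card \<tau>0 = m - 1"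
    by (meson obtain_subset_with_card_n)
  then have T: "finite ?T" "?T \<noteq> {}" by (auto intro: finite_subset[of _ "Pow {1..d}"])
  have "ereal (u j) + ?p (insert i \<tau>) - ?p (insert j \<tau>)
          \<in> {ereal (centre m \<mu> i - N)..ereal (centre m \<mu> i + N)}"
    if \<tau>: "\<tau> \<in> ?T" and j: "j \<in> {1..d} - \<tau>" for \<tau> j
  proof -
    have fin: "finite \<tau>" using \<tau> by (auto intro: finite_subset)
    have p: "?p (insert k \<tau>) = ereal (centre m \<mu> k + sum (centre m \<mu>) \<tau>)"
      if "k \<in> {1..d} - \<tau>" for k
      using that fin \<tau> md(1) by (subst plucker_gauss_matrix) auto
    show ?thesis
      using p[of i] p[OF j] i \<tau> j u[of j] by (auto simp: abs_le_iff)
  qed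
  moreover have "{1..d} - \<tau> \<noteq> {}" if "\<tau> \<in> ?T" for \<tau>
    using that i by auto
  ultimately show ?thesis
    unfolding projected_point_def
    by (intro Max_image_between[OF T] Min_image_between) auto
qed

lemma trop_dist_le:
  assumes "1 \<le> d" "\<And>i. i \<in> {1..d} \<Longrightarrow> v i - w i \<in> {ereal (- B)..ereal B}"
  shows "trop_dist d v w \<le> ereal (2 * B)"
proof -
  have "Max ((\<lambda>i. v i - w i) ` {1..d}) \<in> {ereal (- B)..ereal B}"
    using assms by (intro Max_image_between) auto
  moreover have "Min ((\<lambda>i. v i - w i) ` {1..d}) \<in> {ereal (- B)..ereal B}"
    using assms by (intro Min_image_between) auto
  ultimately have "trop_dist d v w \<le> ereal B - ereal (- B)"
    unfolding trop_dist_def by (intro ereal_minus_mono) auto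
  then show ?thesis by simp
qed

text \<open>
  Both the point and its projection lie within \<open>N\<close> of the centre, so their coordinates differ by at
  most \<open>2 N\<close>, and the tropical distance doubles this once more.
\<close>

lemma trop_dist_projected_point_le:
  assumes md: "1 \<le> m" "m < d"
    and u: "\<And>j. j \<in> {1..d} \<Longrightarrow> \<bar>u j - centre m \<mu> j\<bar> \<le> N"
  shows "trop_dist d (\<lambda>i. ereal (u i)) (projected_point m d (gauss_matrix m \<mu>) u) \<le> ereal (4 * N)"
proof -
  have "ereal (u i) - projected_point m d (gauss_matrix m \<mu>) u i \<in> {ereal (- (2 * N))..ereal (2 * N)}"
    if i: "i \<in> {1..d}" for i
    using projected_point_near_centre[OF md i u] u[OF i]
    by (cases "projected_point m d (gauss_matrix m \<mu>) u i") auto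
  from trop_dist_le[OF _ this] md show ?thesis by simp
qed

lemma sample_point_near_centre:
  assumes "j \<in> {1..d}"
  shows "\<bar>sample_point m \<mu> x y j - centre m \<mu> j\<bar> \<le> \<bar>x\<bar> + (\<Sum>i = 1..d. \<bar>y i\<bar>)"
proof -
  have "\<bar>y j\<bar> \<le> (\<Sum>i = 1..d. \<bar>y i\<bar>)"
    using assms by (intro member_le_sum) auto
  then show ?thesis by (auto simp: sample_point_def centre_def)
qed

lemma nn_integral_abs_normal:
  assumes "0 < \<sigma>" "distributed M lborel Y (normal_density 0 \<sigma>)"
  shows "(\<integral>\<^sup>+ \<omega>. ennreal \<bar>Y \<omega>\<bar> \<partial>M) = ennreal (\<sigma> * sqrt (2 / pi))"
proof -
  have "(\<integral>\<^sup>+ \<omega>. ennreal \<bar>Y \<omega>\<bar> \<partial>M) = (\<integral>\<^sup>+ x. ennreal (normal_density 0 \<sigma> x) * ennreal \<bar>x\<bar> \<partial>lborel)"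
    using distributed_nn_integral[OF assms(2), of "\<lambda>x. ennreal \<bar>x\<bar>"] by simp
  also have "\<dots> = (\<integral>\<^sup>+ x. ennreal (normal_density 0 \<sigma> x * \<bar>x\<bar>) \<partial>lborel)"
    by (simp add: ennreal_mult)
  also have "\<dots> = ennreal (\<sigma> * sqrt (2 / pi))"
    using normal_moment_abs_odd[OF assms(1), of 0 0]
    by (subst nn_integral_eq_integral) (auto simp: has_bochner_integral_iff)
  finally show ?thesis .
qed

theorem theorem14:
  fixes m d :: nat
    and \<mu> :: "nat \<Rightarrow> real"
    and M :: "real \<Rightarrow> 'a measure"
    and e :: "real \<Rightarrow> 'a \<Rightarrow> real"
    and es :: "real \<Rightarrow> nat \<Rightarrow> 'a \<Rightarrow> real"
    and X :: "real \<Rightarrow> 'a \<Rightarrow> nat \<Rightarrow> real"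
    and X' :: "real \<Rightarrow> 'a \<Rightarrow> nat \<Rightarrow> ereal"
  assumes "1 \<le> m" and "m < d"
    and "\<And>\<sigma>. \<sigma> > 0 \<Longrightarrow> prob_space (M \<sigma>)"
    and "\<And>\<sigma>. \<sigma> > 0 \<Longrightarrow> distributed (M \<sigma>) lborel (e \<sigma>) (normal_density 0 \<sigma>)"
    and "\<And>\<sigma> i. \<sigma> > 0 \<Longrightarrow> i \<in> {1..d} \<Longrightarrow>
           distributed (M \<sigma>) lborel (es \<sigma> i) (normal_density 0 \<sigma>)"
    and "\<And>\<sigma>. \<sigma> > 0 \<Longrightarrow>
           prob_space.indep_vars (M \<sigma>) (\<lambda>_. borel) (\<lambda>k. if k = 0 then e \<sigma> else es \<sigma> k) {0..d}"
    and "\<And>\<sigma> \<omega>. X \<sigma> \<omega> = sample_point m \<mu> (e \<sigma> \<omega>) (\<lambda>i. es \<sigma> i \<omega>)"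
    and "\<And>\<sigma> \<omega>. X' \<sigma> \<omega> = projected_point m d (gauss_matrix m \<mu>) (X \<sigma> \<omega>)"
  shows "((\<lambda>\<sigma>. \<integral>\<^sup>+ \<omega>. e2ennreal (trop_dist d (\<lambda>i. ereal (X \<sigma> \<omega> i)) (X' \<sigma> \<omega>)) \<partial>(M \<sigma>))
           \<longlongrightarrow> 0) (at_right 0)"
proof (rule tendsto_sandwich[OF _ _ tendsto_const])
  let ?bound = "\<lambda>\<sigma>. ennreal (4 * real (d + 1) * sqrt (2 / pi) * \<sigma>)"
  have bound: "(\<integral>\<^sup>+ \<omega>. e2ennreal (trop_dist d (\<lambda>i. ereal (X \<sigma> \<omega> i)) (X' \<sigma> \<omega>)) \<partial>M \<sigma>) \<le> ?bound \<sigma>"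
    if \<sigma>: "0 < \<sigma>" for \<sigma>
  proof -
    note e = assms(4)[OF \<sigma>] and es = assms(5)[OF \<sigma>]
    have [measurable]: "e \<sigma> \<in> borel_measurable (M \<sigma>)"
      using distributed_measurable[OF e] by simp
    have [measurable]: "es \<sigma> i \<in> borel_measurable (M \<sigma>)" if "i \<in> {1..d}" for i
      using distributed_measurable[OF es[OF that]] by simp
    let ?N = "\<lambda>\<omega>. \<bar>e \<sigma> \<omega>\<bar> + (\<Sum>i = 1..d. \<bar>es \<sigma> i \<omega>\<bar>)"
    have "trop_dist d (\<lambda>i. ereal (X \<sigma> \<omega> i)) (X' \<sigma> \<omega>) \<le> ereal (4 * ?N \<omega>)" for \<omega>
      unfolding assms(8)
      by (rule trop_dist_projected_point_le[OF assms(1,2)])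
        (unfold assms(7), rule sample_point_near_centre)
    then have "e2ennreal (trop_dist d (\<lambda>i. ereal (X \<sigma> \<omega> i)) (X' \<sigma> \<omega>)) \<le> ennreal (4 * ?N \<omega>)" for \<omega>
      using e2ennreal_mono by (fastforce simp: e2ennreal_ereal)
    then have "(\<integral>\<^sup>+ \<omega>. e2ennreal (trop_dist d (\<lambda>i. ereal (X \<sigma> \<omega> i)) (X' \<sigma> \<omega>)) \<partial>M \<sigma>)
        \<le> (\<integral>\<^sup>+ \<omega>. ennreal (4 * ?N \<omega>) \<partial>M \<sigma>)"
      by (intro nn_integral_mono) auto
    also have "\<dots> = (\<integral>\<^sup>+ \<omega>. 4 * (ennreal \<bar>e \<sigma> \<omega>\<bar> + (\<Sum>i = 1..d. ennreal \<bar>es \<sigma> i \<omega>\<bar>)) \<partial>M \<sigma>)"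
      by (intro nn_integral_cong) (simp add: ennreal_mult ennreal_plus sum_nonneg sum_ennreal)
    also have "\<dots> = 4 * ((\<integral>\<^sup>+ \<omega>. ennreal \<bar>e \<sigma> \<omega>\<bar> \<partial>M \<sigma>)
        + (\<Sum>i = 1..d. \<integral>\<^sup>+ \<omega>. ennreal \<bar>es \<sigma> i \<omega>\<bar> \<partial>M \<sigma>))"
      by (subst nn_integral_cmult, measurable, subst nn_integral_add, measurable,
          subst nn_integral_sum) auto
    also have "\<dots> = 4 * (ennreal (\<sigma> * sqrt (2 / pi)) + (\<Sum>i = 1..d. ennreal (\<sigma> * sqrt (2 / pi))))"
      using nn_integral_abs_normal[OF \<sigma> e] nn_integral_abs_normal[OF \<sigma> es] by simp
    also have "\<dots> = ennreal (4 * (\<sigma> * sqrt (2 / pi) + (\<Sum>i = 1..d. \<sigma> * sqrt (2 / pi))))"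
      using \<sigma> by (subst sum_ennreal)
        (simp_all add: ennreal_mult ennreal_plus sum_nonneg del: sum_constant)
    also have "\<dots> = ?bound \<sigma>"
      by (simp add: algebra_simps)
    finally show ?thesis .
  qed
  then show "\<forall>\<^sub>F \<sigma> in at_right 0.
      (\<integral>\<^sup>+ \<omega>. e2ennreal (trop_dist d (\<lambda>i. ereal (X \<sigma> \<omega> i)) (X' \<sigma> \<omega>)) \<partial>M \<sigma>) \<le> ?bound \<sigma>"
    by (simp add: eventually_at_right_less eventually_mono[OF eventually_at_right_less])
  have "((\<lambda>\<sigma>. 4 * real (d + 1) * sqrt (2 / pi) * \<sigma>) \<longlongrightarrow> 4 * real (d + 1) * sqrt (2 / pi) * 0)
      (at_right 0)"
    by (intro tendsto_intros)
  then show "(?bound \<longlongrightarrow> 0) (at_right 0)"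
    using tendsto_ennrealI by fastforce
qed auto

end
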